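(* If $K$ is a compact semitopological semihypergroup, then $WAP_r(K)=C(K)$.
   Context: All topologies are Hausdorff. For a locally compact Hausdorff space $X$: $M(X)$ is the space of regular complex Borel measures on $X$; $M^+(X)$ is the set of finite non-negative regular Borel measures, with the cone topology (the weakest topology making $\mu\mapsto\int_X f\,d\mu$ continuous for every $f\in C_c^+(X)\cup\{1_X\}$, where $C_c^+(X)$ is the set of non-negative compactly supported continuous functions and $1_X$ is the constant function $1$); $\mathfrak{C}(X)$ is the set of compact subsets of $X$ with the Michael topology, generated by the sub-basis of sets $\{C\in\mathfrak{C}(X): C\cap U\neq\emptyset,\ C\subset V\}$ for $U,V$ open in $X$; $p_x$ is the point mass at $x$. A semitopological semihypergroup is a pair $(K,* )$ such that: (A1) $K$ is a locally compact Hausdorff space and $*$ is a binary operation making $M(K)$ an associative algebra; (A2) $*$ sends $M^+(K)\times M^+(K)$ into $M^+(K)$ and for each $\omega\in M^+(K)$ both maps $\mu\mapsto\omega*\mu$ and $\mu\mapsto\mu*\omega$ from $M^+(K)$ to $M^+(K)$ are continuous; (A3) for all $x,y\in K$, $p_x*p_y$ is a probability measure with compact support; (A4) the map $(x,y)\mapsto \mathrm{supp}(p_x*p_y)$, $K\times K\to\mathfrak{C}(K)$, is continuous. It is compact if $K$ is compact. $C(K)$ is the space of bounded continuous complex-valued functions on $K$ with the supremum norm. For measurable $f$ on $K$ and $x,y\in K$, $R_yf(x)=f(x*y):=\int_K f\,d(p_x*p_y)$. $WAP_r(K)$ is the set of $f\in C(K)$ such that $\{R_xf:x\in K\}$ is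 relatively compact in the weak topology of the Banach space $C(K)$. *)

theory Defs
  imports "HOL-Probability.Probability"
begin

text \<open>
  The library has no complex measures.  Here a complex Borel measure is a countably additive
  set function on the Borel sets; it is required to vanish on all other sets, so that equality
  of measures is equality of functions.  The vector space structure is the pointwise one.
\<close>

definition complex_borel_measure :: "('a::topological_space set \<Rightarrow> complex) \<Rightarrow> bool" where
  "complex_borel_measure \<mu> \<longleftrightarrow>
     (\<forall>A. A \<notin> sets borel \<longrightarrow> \<mu> A = 0) \<and>
     (\<forall>A::nat \<Rightarrow> 'a set. range A \<subseteq> sets borel \<longrightarrow> disjoint_family A \<longrightarrow>
        (\<lambda>n. \<mu> (A n)) sums \<mu> (\<Union>n. A n))"

definition total_variation :: "('a::topological_space set \<Rightarrow> complex) \<Rightarrow> 'a set \<Rightarrow> ennreal" where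
  "total_variation \<mu> E =
     (SUP A\<in>{A::nat \<Rightarrow> 'a set. range A \<subseteq> sets borel \<and> disjoint_family A \<and> (\<Union>n. A n) = E}.
        \<Sum>n. ennreal (cmod (\<mu> (A n))))"

definition regular_measure :: "('a::topological_space set \<Rightarrow> complex) \<Rightarrow> bool" where
  "regular_measure \<mu> \<longleftrightarrow>
     (\<forall>E\<in>sets borel.
        total_variation \<mu> E = (INF V\<in>{V. open V \<and> E \<subseteq> V}. total_variation \<mu> V) \<and>
        total_variation \<mu> E = (SUP C\<in>{C. compact C \<and> C \<subseteq> E}. total_variation \<mu> C))"

definition M_space :: "('a::t2_space set \<Rightarrow> complex) set" where
  "M_space = {\<mu>. complex_borel_measure \<mu> \<and> regular_measure \<mu>}"

definition M_plus :: "('a::t2_space set \<Rightarrow> complex) set" where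
  "M_plus = {\<mu> \<in> M_space. \<forall>A. Im (\<mu> A) = 0 \<and> 0 \<le> Re (\<mu> A)}"

definition point_mass :: "'a::t2_space \<Rightarrow> 'a set \<Rightarrow> complex" where
  "point_mass x A = (if A \<in> sets borel \<and> x \<in> A then 1 else 0)"

definition msupp :: "('a::t2_space set \<Rightarrow> complex) \<Rightarrow> 'a set" where
  "msupp \<mu> = - \<Union>{U. open U \<and> total_variation \<mu> U = 0}"

text \<open>
  The library measure corresponding to an element of \<open>M\<^sup>+(X)\<close>, used to integrate against it
  (meaningful for elements of \<open>M\<^sup>+(X)\<close> only).
\<close>

definition to_measure :: "('a::t2_space set \<Rightarrow> complex) \<Rightarrow> 'a measure" where
  "to_measure \<mu> = measure_of UNIV (sets borel) (\<lambda>A. ennreal (Re (\<mu> A)))"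

lemma sets_to_measure [simp]: "sets (to_measure \<mu>) = sets borel"
  unfolding to_measure_def
  by (metis sets.sets_measure_of_eq space_borel)

lemma emeasure_to_measure:
  assumes "\<mu> \<in> M_plus" "A \<in> sets borel"
  shows "emeasure (to_measure \<mu>) A = ennreal (Re (\<mu> A))"
proof (rule emeasure_measure_of[OF to_measure_def])
  have nn: "0 \<le> Re (\<mu> B)" for B
    using assms(1) by (auto simp: M_plus_def)
  have ca: "(\<lambda>n. \<mu> (B n)) sums \<mu> (\<Union>n. B n)"
    if "range B \<subseteq> sets borel" "disjoint_family B" for B :: "nat \<Rightarrow> 'a set"
    using assms(1) that by (auto simp: M_plus_def M_space_def complex_borel_measure_def)
  show "sets borel \<subseteq> Pow UNIV" by simp
  show "A \<in> sets (to_measure \<mu>)" using assms(2) by simp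
  show "positive (sets (to_measure \<mu>)) (\<lambda>A. ennreal (Re (\<mu> A)))"
  proof -
    have "(\<lambda>n::nat. \<mu> {}) sums \<mu> {}"
      using ca[of "\<lambda>_. {}"] by (simp add: disjoint_family_on_def)
    then have "\<mu> {} = 0"
      using summable_const_iff sums_summable by blast
    then show ?thesis by (simp add: positive_def)
  qed
  show "countably_additive (sets (to_measure \<mu>)) (\<lambda>A. ennreal (Re (\<mu> A)))"
  proof (rule countably_additiveI)
    fix B :: "nat \<Rightarrow> 'a set"
    assume "range B \<subseteq> sets (to_measure \<mu>)" "disjoint_family B"
    then have "(\<lambda>n. Re (\<mu> (B n))) sums Re (\<mu> (\<Union>n. B n))"
      using ca sums_Re by auto
    then show "(\<Sum>n. ennreal (Re (\<mu> (B n)))) = ennreal (Re (\<mu> (\<Union>n. B n)))"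
      using nn by (intro suminf_ennreal_eq) auto
  qed
qed

definition Cc_plus :: "('a::t2_space \<Rightarrow> real) set" where
  "Cc_plus = {f. continuous_on UNIV f \<and> (\<forall>x. 0 \<le> f x) \<and> compact (closure {x. f x \<noteq> 0})}"

definition cone_topology :: "('a::t2_space set \<Rightarrow> complex) topology" where
  "cone_topology = topology_generated_by
     {{\<mu> \<in> M_plus. (\<integral>x. f x \<partial>to_measure \<mu>) \<in> U} | f U. f \<in> Cc_plus \<union> {\<lambda>_. 1::real} \<and> open U}"

lemma topspace_cone_topology [simp]: "topspace cone_topology = M_plus"
  unfolding cone_topology_def topology_generated_by_topspace
  by (auto intro!: exI[of _ M_plus] exI[of _ UNIV] exI[of _ "\<lambda>_. 1::real"])

text \<open>
  The set of all compact sets is included among the generators so that the empty set, which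
  lies in no other sub-basic set, belongs to the underlying space.
\<close>

definition michael_topology :: "'a::t2_space set topology" where
  "michael_topology = topology_generated_by
     (insert {C. compact C}
        {{C. compact C \<and> C \<inter> U \<noteq> {} \<and> C \<subseteq> V} | U V. open U \<and> open V})"

lemma topspace_michael_topology [simp]: "topspace michael_topology = {C. compact C}"
  unfolding michael_topology_def topology_generated_by_topspace by auto

text \<open>
  The library type of bounded continuous
  functions is only a real Banach space, so complex homogeneity is stated explicitly.
\<close>

definition complex_dual :: "(('a::topological_space \<Rightarrow>\<^sub>C complex) \<Rightarrow> complex) set" where
  "complex_dual = {\<phi>. bounded_linear \<phi> \<and>
     (\<forall>c f. \<phi> (Bcontfun (\<lambda>x. c * apply_bcontfun f x)) = c * \<phi> f)}"

definition weak_topology :: "('a::topological_space \<Rightarrow>\<^sub>C complex) topology" where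
  "weak_topology = topology_generated_by {\<phi> -` U | \<phi> U. \<phi> \<in> complex_dual \<and> open U}"

definition relatively_compact_in :: "'b topology \<Rightarrow> 'b set \<Rightarrow> bool" where
  "relatively_compact_in X S \<longleftrightarrow> S \<subseteq> topspace X \<and> compactin X (X closure_of S)"

lemma topspace_weak_topology [simp]: "topspace weak_topology = UNIV"
proof -
  have "(\<lambda>_. 0) \<in> complex_dual" by (simp add: complex_dual_def)
  then show ?thesis
    unfolding weak_topology_def topology_generated_by_topspace
    by (auto intro!: exI[of _ UNIV] exI[of _ "\<lambda>_. 0"])
qed

locale semitopological_semihypergroup =
  fixes conv :: "('a::t2_space set \<Rightarrow> complex) \<Rightarrow> ('a set \<Rightarrow> complex) \<Rightarrow> ('a set \<Rightarrow> complex)"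
    (infixl "\<star>" 70)
  assumes locally_compact: "locally_compact_space (euclidean :: 'a topology)"
    and mult_closed: "\<And>\<mu> \<nu>. \<lbrakk>\<mu> \<in> M_space; \<nu> \<in> M_space\<rbrakk> \<Longrightarrow> \<mu> \<star> \<nu> \<in> M_space"
    and assoc: "\<And>\<mu> \<nu> \<omega>. \<lbrakk>\<mu> \<in> M_space; \<nu> \<in> M_space; \<omega> \<in> M_space\<rbrakk> \<Longrightarrow>
      (\<mu> \<star> \<nu>) \<star> \<omega> = \<mu> \<star> (\<nu> \<star> \<omega>)"
    and add_left: "\<And>\<mu> \<nu> \<omega>. \<lbrakk>\<mu> \<in> M_space; \<nu> \<in> M_space; \<omega> \<in> M_space\<rbrakk> \<Longrightarrow>
      (\<lambda>A. \<mu> A + \<nu> A) \<star> \<omega> = (\<lambda>A. (\<mu> \<star> \<omega>) A + (\<nu> \<star> \<omega>) A)"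
    and add_right: "\<And>\<mu> \<nu> \<omega>. \<lbrakk>\<mu> \<in> M_space; \<nu> \<in> M_space; \<omega> \<in> M_space\<rbrakk> \<Longrightarrow>
      \<omega> \<star> (\<lambda>A. \<mu> A + \<nu> A) = (\<lambda>A. (\<omega> \<star> \<mu>) A + (\<omega> \<star> \<nu>) A)"
    and scale_left: "\<And>c \<mu> \<nu>. \<lbrakk>\<mu> \<in> M_space; \<nu> \<in> M_space\<rbrakk> \<Longrightarrow>
      (\<lambda>A. c * \<mu> A) \<star> \<nu> = (\<lambda>A. c * (\<mu> \<star> \<nu>) A)"
    and scale_right: "\<And>c \<mu> \<nu>. \<lbrakk>\<mu> \<in> M_space; \<nu> \<in> M_space\<rbrakk> \<Longrightarrow>
      \<mu> \<star> (\<lambda>A. c * \<nu> A) = (\<lambda>A. c * (\<mu> \<star> \<nu>) A)"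
    and positive: "\<And>\<mu> \<nu>. \<lbrakk>\<mu> \<in> M_plus; \<nu> \<in> M_plus\<rbrakk> \<Longrightarrow> \<mu> \<star> \<nu> \<in> M_plus"
    and continuous_right: "\<And>\<omega>. \<omega> \<in> M_plus \<Longrightarrow>
      continuous_map cone_topology cone_topology (\<lambda>\<mu>. \<omega> \<star> \<mu>)"
    and continuous_left: "\<And>\<omega>. \<omega> \<in> M_plus \<Longrightarrow>
      continuous_map cone_topology cone_topology (\<lambda>\<mu>. \<mu> \<star> \<omega>)"
    and probability: "\<And>x y. prob_space (to_measure (point_mass x \<star> point_mass y))"
    and compact_support: "\<And>x y. compact (msupp (point_mass x \<star> point_mass y))"
    and continuous_support: "continuous_map euclidean michael_topology
      (\<lambda>(x, y). msupp (point_mass x \<star> point_mass y))"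

definition right_translate ::
  "(('a::t2_space set \<Rightarrow> complex) \<Rightarrow> ('a set \<Rightarrow> complex) \<Rightarrow> ('a set \<Rightarrow> complex)) \<Rightarrow>
     'a \<Rightarrow> ('a \<Rightarrow> complex) \<Rightarrow> 'a \<Rightarrow> complex" where
  "right_translate conv y f = (\<lambda>x. \<integral>t. f t \<partial>to_measure (conv (point_mass x) (point_mass y)))"

text \<open>
  The translates must be elements of \<open>C(K)\<close> for their weak closure to make sense; this is made
  part of the definition because \<open>Bcontfun\<close> is unspecified outside \<open>bcontfun\<close>.
\<close>

definition WAP_r ::
  "(('a::t2_space set \<Rightarrow> complex) \<Rightarrow> ('a set \<Rightarrow> complex) \<Rightarrow> ('a set \<Rightarrow> complex)) \<Rightarrow>
     ('a \<Rightarrow> complex) set" where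
  "WAP_r conv = {f \<in> bcontfun.
     (\<forall>x. right_translate conv x f \<in> bcontfun) \<and>
     relatively_compact_in weak_topology (range (\<lambda>x. Bcontfun (right_translate conv x f)))}"

end

theory Submission
  imports Defs
begin

text \<open>
  Let \<open>f\<close> be continuous on the compact space \<open>K\<close>.  The function \<open>(x, y) \<mapsto> f (x * y)\<close> is bounded and
  separately continuous, since point masses depend continuously on their points in the cone
  topology, convolution with a fixed measure is continuous there, and on probability measures
  so is integration of \<open>f\<close> (\<open>continuous_on_integral_complex\<close>).  In particular every translate of \<open>f\<close>
  is continuous.  The claim is that \<open>y \<mapsto> R\<^sub>y f\<close> is continuous into \<open>C(K)\<close> with the weak topology.
  Then the set of translates, the image of \<open>K\<close>, is weakly compact, and weakly closed because the
  weak topology is Hausdorff.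

  The weak continuity is an instance of a theorem of Grothendieck: a bounded, separately
  continuous function \<open>F\<close> on a product of compact spaces gives a weakly continuous map
  \<open>y \<mapsto> F(\<cdot>, y)\<close> (\<open>separately_continuous_imp_weakly_continuous\<close>).  Its proof has two ingredients.

  The first is dominated convergence for sequences: a bounded functional \<open>L\<close> is not bounded away
  from \<open>0\<close> on a uniformly bounded sequence of continuous functions that tends to \<open>0\<close> pointwise
  (\<open>functional_small_if_pointwise_null\<close>).  The supremum of \<open>L\<close> over all functions whose norm is
  dominated by \<open>u\<close> is additive in \<open>u\<close>, and for additive functionals the result follows from Dini's theorem
  (\<open>dominated_convergence_additive\<close>).

  The second is the passage from closures to sequences (\<open>pointwise_null_sequence_in_set\<close>): if \<open>y0\<close>
  is in the closure of \<open>S\<close>, some sequence \<open>y\<close> in \<open>S\<close> satisfies \<open>F(x, y n) \<rightarrow> F(x, y0)\<close> for every \<open>x\<close>.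
  Applied to a set \<open>S\<close> on which \<open>L (F(\<cdot>, y))\<close> stays away from \<open>L (F(\<cdot>, y0))\<close>, it contradicts the first.
\<close>

section \<open>Dominated convergence for additive functionals\<close>

definition cont_nonneg :: "('a::topological_space \<Rightarrow> real) set" where
  "cont_nonneg = {u. continuous_on UNIV u \<and> (\<forall>x. 0 \<le> u x)}"

lemma cont_nonneg_add: "u \<in> cont_nonneg \<Longrightarrow> v \<in> cont_nonneg \<Longrightarrow> (\<lambda>x. u x + v x) \<in> cont_nonneg"
  by (auto simp: cont_nonneg_def intro!: continuous_intros)

lemma cont_nonneg_min: "u \<in> cont_nonneg \<Longrightarrow> v \<in> cont_nonneg \<Longrightarrow> (\<lambda>x. min (u x) (v x)) \<in> cont_nonneg"
  by (auto simp: cont_nonneg_def intro!: continuous_intros)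

lemma cont_nonneg_max: "u \<in> cont_nonneg \<Longrightarrow> v \<in> cont_nonneg \<Longrightarrow> (\<lambda>x. max (u x) (v x)) \<in> cont_nonneg"
  by (auto simp: cont_nonneg_def le_max_iff_disj intro!: continuous_intros)

lemma cont_nonneg_bounded:
  fixes u :: "'a::topological_space \<Rightarrow> real"
  assumes K: "compact (UNIV :: 'a set)" and u: "u \<in> cont_nonneg"
  obtains c where "\<And>x. u x \<le> c"
proof -
  have "bounded (range u)"
    using u K by (intro compact_imp_bounded compact_continuous_image) (auto simp: cont_nonneg_def)
  then obtain c where "\<And>y. y \<in> range u \<Longrightarrow> norm y \<le> c"
    unfolding bounded_iff by blast
  then have "u x \<le> c" for x
    using abs_ge_self[of "u x"] by (metis order_trans rangeI real_norm_def)
  then show ?thesis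
    by (rule that)
qed

lemma Dini_decreasing_to_zero:
  fixes G :: "nat \<Rightarrow> 'a::topological_space \<Rightarrow> real"
  assumes "compact (UNIV :: 'a set)"
    and cont: "\<And>n. continuous_on UNIV (G n)"
    and decr: "\<And>n x. G (Suc n) x \<le> G n x"
    and lim: "\<And>x. (\<lambda>n. G n x) \<longlonglongrightarrow> 0"
    and "0 < e"
  obtains n where "\<And>x. G n x < e"
proof -
  let ?U = "\<lambda>n. {x. G n x < e}"
  have "open (?U n)" for n
    using cont by (intro open_Collect_less) auto
  moreover have "UNIV \<subseteq> (\<Union>n. ?U n)"
  proof
    fix x
    have "\<forall>\<^sub>F n in sequentially. G n x < e"
      using lim[of x] \<open>0 < e\<close> by (rule order_tendstoD)
    then show "x \<in> (\<Union>n. ?U n)"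
      by (auto simp: eventually_sequentially)
  qed
  ultimately obtain I where I: "finite I" "UNIV \<subseteq> (\<Union>n\<in>I. ?U n)"
    using compactE_image[OF assms(1), of UNIV ?U] by metis
  have dec: "G n x \<le> G m x" if "m \<le> n" for m n x
    using lift_Suc_antimono_le[of "\<lambda>n. G n x", OF decr that] .
  show ?thesis
  proof (rule that[of "Max I"])
    fix x
    obtain m where "m \<in> I" "G m x < e"
      using I(2) by auto
    then show "G (Max I) x < e"
      using dec[of m "Max I" x] I(1) by auto
  qed
qed

text \<open>
  The model for \<open>p\<close> is integration against a finite measure on the non-negative continuous
  functions, and the argument replaces countable additivity by compactness.  If all values
  \<open>p (g n)\<close> were at least \<open>e\<close>, consider the tail suprema \<open>sup {g k x | k \<ge> i}\<close>, which still tend to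
  \<open>0\<close> pointwise but need not be continuous.  Finite maxima \<open>H i m\<close> approximate them from below so
  well with respect to \<open>p\<close> that even the minimum \<open>G n\<close> of the approximants of the first \<open>n + 1\<close>
  tails loses at most \<open>e / 2\<close>.  The \<open>G n\<close> are continuous and decrease to \<open>0\<close>, so by Dini's theorem
  they do so uniformly, which forces \<open>p (G n)\<close> below \<open>e / 2\<close>.
\<close>

lemma dominated_convergence_additive:
  fixes p :: "('a::topological_space \<Rightarrow> real) \<Rightarrow> real" and g :: "nat \<Rightarrow> 'a \<Rightarrow> real"
  assumes K: "compact (UNIV :: 'a set)"
    and add: "\<And>u v. u \<in> cont_nonneg \<Longrightarrow> v \<in> cont_nonneg \<Longrightarrow> p (\<lambda>x. u x + v x) = p u + p v"
    and nonneg: "\<And>u. u \<in> cont_nonneg \<Longrightarrow> 0 \<le> p u"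
    and bound: "\<And>u c. u \<in> cont_nonneg \<Longrightarrow> (\<And>x. u x \<le> c) \<Longrightarrow> p u \<le> N * c"
    and g: "\<And>n. g n \<in> cont_nonneg" "\<And>n x. g n x \<le> B"
    and lim: "\<And>x. (\<lambda>n. g n x) \<longlonglongrightarrow> 0"
    and "0 < e"
  shows "\<exists>n. p (g n) < e"
proof (rule ccontr)
  assume "\<not> ?thesis"
  then have ge: "e \<le> p (g n)" for n
    by (auto simp: not_less)
  have mono: "p u \<le> p v" if "u \<in> cont_nonneg" "v \<in> cont_nonneg" "\<And>x. u x \<le> v x" for u v
  proof -
    have d: "(\<lambda>x. v x - u x) \<in> cont_nonneg"
      using that by (auto simp: cont_nonneg_def intro!: continuous_intros)
    show ?thesis
      using add[OF that(1) d] nonneg[OF d] by simp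
  qed
  define H where "H i m x = Max ((\<lambda>k. g k x) ` {i..i + m})" for i m x
  have H_Suc: "H i (Suc m) = (\<lambda>x. max (g (Suc (i + m)) x) (H i m x))" for i m
    unfolding H_def by (simp add: atLeastAtMostSuc_conv)
  have H_pos: "H i m \<in> cont_nonneg" for i m
  proof (induction m)
    case 0
    show ?case
      using g(1)[of i] by (simp add: H_def[abs_def])
  next
    case (Suc m)
    then show ?case
      unfolding H_Suc by (intro cont_nonneg_max g(1))
  qed
  have H_mono: "H i m x \<le> H j n x" if "{i..i + m} \<subseteq> {j..j + n}" for i m j n x
    unfolding H_def using that by (intro Max_mono) auto
  have g_le_H: "g i x \<le> H i m x" for i m x
    unfolding H_def by (intro Max_ge) auto
  define s where "s i = (SUP m. p (H i m))" for i
  have "H i m x \<le> B" for i m x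
    unfolding H_def using g(2) by (subst Max_le_iff) auto
  then have bdd: "bdd_above (range (\<lambda>m. p (H i m)))" for i
    using bound[OF H_pos] by (intro bdd_aboveI2[of _ _ "N * B"]) auto
  have H_le_s: "p (H i m) \<le> s i" for i m
    unfolding s_def using bdd by (intro cSUP_upper) auto
  \<comment> \<open>The permitted losses \<open>d i\<close> add up to at most \<open>e / 2\<close>.\<close>
  define d where "d i = e / 2 ^ (i + 2)" for i
  have "\<exists>m. s i - d i < p (H i m)" for i
  proof -
    have "s i - d i < s i"
      using \<open>0 < e\<close> by (simp add: d_def)
    then show ?thesis
      unfolding s_def using less_cSUP_iff[OF _ bdd, of "s i - d i" i] by (auto simp: s_def)
  qed
  then obtain m where m: "\<And>i. s i - d i < p (H i (m i))"
    by metis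
  define G where "G = rec_nat (H 0 (m 0)) (\<lambda>n G x. min (G x) (H (Suc n) (m (Suc n)) x))"
  have G_0: "G 0 = H 0 (m 0)"
    and G_Suc: "G (Suc n) = (\<lambda>x. min (G n x) (H (Suc n) (m (Suc n)) x))" for n
    by (simp_all add: G_def)
  have G_pos: "G n \<in> cont_nonneg" for n
    by (induction n) (auto simp: G_0 G_Suc intro!: H_pos cont_nonneg_min)
  have G_le: "G n x \<le> H n (m n) x" for n x
    by (cases n) (auto simp: G_0 G_Suc)
  have main: "s n - (\<Sum>i\<le>n. d i) \<le> p (G n)" for n
  proof (induction n)
    case 0
    show ?case
      using m[of 0] by (simp add: G_0)
  next
    case (Suc n)
    let ?f = "H (Suc n) (m (Suc n))"
    let ?M = "\<lambda>x. max (G n x) (?f x)"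
    have M_pos: "?M \<in> cont_nonneg"
      by (intro cont_nonneg_max G_pos H_pos)
    \<comment> \<open>\<open>min\<close> and \<open>max\<close> have the same sum as the two functions, and the maximum is still below a
        tail maximum starting at \<open>n\<close>.\<close>
    have "p (G (Suc n)) + p ?M = p (\<lambda>x. G (Suc n) x + ?M x)"
      using add[OF G_pos[of "Suc n"] M_pos] by simp
    also have "(\<lambda>x. G (Suc n) x + ?M x) = (\<lambda>x. G n x + ?f x)"
      by (auto simp: G_Suc fun_eq_iff)
    also have "p \<dots> = p (G n) + p ?f"
      by (rule add[OF G_pos H_pos])
    finally have eq: "p (G (Suc n)) + p ?M = p (G n) + p ?f" .
    have "?M x \<le> H n (max (m n) (Suc (m (Suc n)))) x" for x
      using G_le[of n x] H_mono[of n "m n" n "max (m n) (Suc (m (Suc n)))" x]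
        H_mono[of "Suc n" "m (Suc n)" n "max (m n) (Suc (m (Suc n)))" x] by auto
    then have "p ?M \<le> s n"
      using mono[OF M_pos H_pos] H_le_s order_trans by blast
    then show ?case
      using eq Suc.IH m[of "Suc n"] by simp
  qed
  have sum_d: "(\<Sum>i\<le>n. d i) \<le> e / 2" for n
  proof -
    have "(\<Sum>i\<le>n. d i) = e / 2 - d n"
      by (induction n) (simp_all add: d_def field_simps)
    then show ?thesis
      using \<open>0 < e\<close> by (simp add: d_def)
  qed
  have G_ge: "e / 2 \<le> p (G n)" for n
  proof -
    have "e \<le> s n"
      using ge[of n] mono[OF g(1) H_pos, of n n 0] g_le_H[of n _ 0] H_le_s[of n 0] by fastforce
    then show ?thesis
      using main[of n] sum_d[of n] by simp
  qed
  have H_lim: "(\<lambda>n. H n (m n) x) \<longlonglongrightarrow> 0" for x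
  proof (rule LIMSEQ_I)
    fix r :: real assume "0 < r"
    then obtain n0 where n0: "\<And>n. n \<ge> n0 \<Longrightarrow> g n x < r"
      using order_tendstoD(2)[OF lim[of x]] by (auto simp: eventually_sequentially)
    have "norm (H n (m n) x - 0) < r" if "n \<ge> n0" for n
    proof -
      have "H n (m n) x < r"
        unfolding H_def using n0 that by (subst Max_less_iff) auto
      then show ?thesis
        using H_pos[of n "m n"] by (simp add: cont_nonneg_def)
    qed
    then show "\<exists>no. \<forall>n\<ge>no. norm (H n (m n) x - 0) < r"
      by blast
  qed
  have G_lim: "(\<lambda>n. G n x) \<longlonglongrightarrow> 0" for x
    using G_pos by (intro tendsto_sandwich[OF _ _ tendsto_const H_lim[of x]])
      (auto simp: G_le cont_nonneg_def)
  have cont_G: "continuous_on UNIV (G n)" and decr_G: "G (Suc n) x \<le> G n x" for n x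
    using G_pos by (auto simp: cont_nonneg_def G_Suc)
  have "0 < e / (4 * (\<bar>N\<bar> + 1))"
    using \<open>0 < e\<close> by simp
  then obtain n where n: "\<And>x. G n x < e / (4 * (\<bar>N\<bar> + 1))"
    using Dini_decreasing_to_zero[OF K cont_G decr_G G_lim] by blast
  have "p (G n) \<le> N * (e / (4 * (\<bar>N\<bar> + 1)))"
    using n by (intro bound[OF G_pos] less_imp_le)
  also have "\<dots> \<le> (\<bar>N\<bar> + 1) * (e / (4 * (\<bar>N\<bar> + 1)))"
    using \<open>0 < e\<close> by (intro mult_right_mono) auto
  also have "\<dots> = e / 4"
    using abs_ge_zero[of N] by (simp add: field_simps)
  finally show False
    using G_ge[of n] \<open>0 < e\<close> by simp
qed

section \<open>The majorant of a bounded functional\<close>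

lemma bcontfun_if_continuous:
  fixes f :: "'a::topological_space \<Rightarrow> 'b::metric_space"
  assumes "compact (UNIV :: 'a set)" and "continuous_on UNIV f"
  shows "f \<in> bcontfun"
  using assms by (auto simp: bcontfun_def intro: compact_imp_bounded compact_continuous_image)

lemma functional_le_onorm_mult:
  fixes L :: "('a::topological_space \<Rightarrow>\<^sub>C 'b::real_normed_vector) \<Rightarrow> real"
  assumes L: "bounded_linear L" and h: "\<And>x. norm (apply_bcontfun h x) \<le> c"
  shows "L h \<le> onorm L * c"
proof -
  have "L h \<le> norm (L h)"
    by simp
  also have "\<dots> \<le> onorm L * norm h"
    by (rule onorm[OF L])
  also have "\<dots> \<le> onorm L * c"
    using h by (intro mult_left_mono onorm_pos_le[OF L] norm_bound)
  finally show ?thesis .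
qed

text \<open>
  If \<open>L\<close> is integration of scalar functions against a measure \<open>\<mu>\<close>, the majorant is integration of
  non-negative continuous functions against the total variation of \<open>\<mu>\<close>.
\<close>

definition majorant :: "(('a::topological_space \<Rightarrow>\<^sub>C 'b::real_normed_vector) \<Rightarrow> real) \<Rightarrow> ('a \<Rightarrow> real) \<Rightarrow> real"
  where "majorant L u = (SUP h\<in>{h. \<forall>x. norm (apply_bcontfun h x) \<le> u x}. L h)"

context
  fixes L :: "('a::topological_space \<Rightarrow>\<^sub>C 'b::real_normed_vector) \<Rightarrow> real"
  assumes K: "compact (UNIV :: 'a set)" and L: "bounded_linear L"
begin

interpretation L: bounded_linear L
  by (rule L)

lemma bdd_above_majorant:
  assumes "u \<in> cont_nonneg"
  shows "bdd_above (L ` {h. \<forall>x. norm (apply_bcontfun h x) \<le> u x})"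
proof -
  obtain c where "\<And>x. u x \<le> c"
    using cont_nonneg_bounded[OF K assms] by blast
  then show ?thesis
    by (intro bdd_aboveI2[of _ _ "onorm L * c"] functional_le_onorm_mult[OF L]) (auto intro: order_trans)
qed

lemma le_majorant:
  assumes "u \<in> cont_nonneg" "\<And>x. norm (apply_bcontfun h x) \<le> u x"
  shows "L h \<le> majorant L u"
  unfolding majorant_def using assms bdd_above_majorant[OF assms(1)]
  by (intro cSUP_upper) auto

lemma majorant_leI:
  assumes "u \<in> cont_nonneg"
    and "\<And>h. (\<And>x. norm (apply_bcontfun h x) \<le> u x) \<Longrightarrow> L h \<le> c"
  shows "majorant L u \<le> c"
  unfolding majorant_def
proof (rule cSUP_least)
  show "{h. \<forall>x. norm (apply_bcontfun h x) \<le> u x} \<noteq> {}"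
    using assms(1) by (auto simp: cont_nonneg_def intro!: exI[of _ 0])
qed (use assms(2) in auto)

lemma majorant_nonneg: "u \<in> cont_nonneg \<Longrightarrow> 0 \<le> majorant L u"
  using le_majorant[of u 0] by (simp add: L.zero cont_nonneg_def)

lemma majorant_le_onorm_mult:
  "u \<in> cont_nonneg \<Longrightarrow> (\<And>x. u x \<le> c) \<Longrightarrow> majorant L u \<le> onorm L * c"
  by (intro majorant_leI functional_le_onorm_mult[OF L]) (auto intro: order_trans)

text \<open>
  One inequality adds up two functions bounded by \<open>u\<close> and by \<open>v\<close>; the other one distributes a
  function bounded by \<open>u + v\<close> over \<open>u\<close> and \<open>v\<close> in proportion to their values.
\<close>

lemma majorant_add:
  assumes u: "u \<in> cont_nonneg" and v: "v \<in> cont_nonneg"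
  shows "majorant L (\<lambda>x. u x + v x) = majorant L u + majorant L v"
proof (rule antisym)
  have uv: "(\<lambda>x. u x + v x) \<in> cont_nonneg"
    by (rule cont_nonneg_add[OF u v])
  show "majorant L (\<lambda>x. u x + v x) \<le> majorant L u + majorant L v"
  proof (rule majorant_leI[OF uv])
    fix h :: "'a \<Rightarrow>\<^sub>C 'b"
    assume h: "\<And>x. norm (apply_bcontfun h x) \<le> u x + v x"
    show "L h \<le> majorant L u + majorant L v"
    proof (rule field_le_epsilon)
      fix e :: real assume "0 < e"
      define d where "d = e / (onorm L + 1)"
      have N: "0 \<le> onorm L"
        by (rule onorm_pos_le[OF L])
      then have "0 < d"
        using \<open>0 < e\<close> by (simp add: d_def)
      have pos: "0 \<le> u x" "0 \<le> v x" "0 < u x + v x + d" for x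
        using u v \<open>0 < d\<close> by (auto simp: cont_nonneg_def add_nonneg_pos)
      \<comment> \<open>Splitting \<open>h\<close> in the proportion \<open>u : v\<close> could fail to be continuous where both vanish; the
          added constant \<open>d\<close> prevents this at the price of a small third summand.\<close>
      define part where "part w = Bcontfun (\<lambda>x. (w x / (u x + v x + d)) *\<^sub>R apply_bcontfun h x)" for w
      have part: "apply_bcontfun (part w) x = (w x / (u x + v x + d)) *\<^sub>R apply_bcontfun h x"
        if "continuous_on UNIV w" for w x
      proof -
        have "(\<lambda>x. (w x / (u x + v x + d)) *\<^sub>R apply_bcontfun h x) \<in> bcontfun"
          using u v that pos(3) by (intro bcontfun_if_continuous[OF K] continuous_intros)
            (auto simp: cont_nonneg_def less_imp_neq[THEN not_sym])
        then show ?thesis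
          unfolding part_def by (simp add: Bcontfun_inverse)
      qed
      have part_le: "norm (apply_bcontfun (part w) x) \<le> w x"
        if "continuous_on UNIV w" "\<And>x. 0 \<le> w x" for w x
      proof -
        have "norm (apply_bcontfun (part w) x) = w x * (norm (apply_bcontfun h x) / (u x + v x + d))"
          using that(2)[of x] pos(3)[of x] by (simp add: part[OF that(1)])
        also have "\<dots> \<le> w x * 1"
          using that(2)[of x] pos(3)[of x] h[of x] \<open>0 < d\<close> by (intro mult_left_mono) (auto simp: field_simps)
        finally show ?thesis by simp
      qed
      have cu: "continuous_on UNIV u" and cv: "continuous_on UNIV v"
        using u v by (auto simp: cont_nonneg_def)
      have split: "h = part u + part v + part (\<lambda>_. d)"
      proof (rule bcontfun_eqI)
        fix x
        have "u x / (u x + v x + d) + v x / (u x + v x + d) + d / (u x + v x + d) = 1"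
          using pos(3)[of x] by (simp add: add_divide_distrib[symmetric])
        then show "apply_bcontfun h x = apply_bcontfun (part u + part v + part (\<lambda>_. d)) x"
          by (simp add: part cu cv scaleR_left_distrib[symmetric])
      qed
      have "L (part (\<lambda>_. d)) \<le> onorm L * d"
        using part_le[of "\<lambda>_. d"] \<open>0 < d\<close> by (intro functional_le_onorm_mult[OF L]) auto
      also have "\<dots> \<le> e"
        using N \<open>0 < e\<close> by (simp add: d_def field_simps)
      finally have "L (part (\<lambda>_. d)) \<le> e" .
      moreover have "L (part u) \<le> majorant L u" "L (part v) \<le> majorant L v"
        using part_le[OF cu pos(1)] part_le[OF cv pos(2)] le_majorant[OF u] le_majorant[OF v] by auto
      ultimately show "L h \<le> majorant L u + majorant L v + e"
        by (subst split) (simp add: L.add)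
    qed
  qed
  have sum_le: "L a + L b \<le> majorant L (\<lambda>x. u x + v x)"
    if "\<And>x. norm (apply_bcontfun a x) \<le> u x" "\<And>x. norm (apply_bcontfun b x) \<le> v x" for a b
    unfolding L.add[symmetric] using that
    by (intro le_majorant[OF uv]) (auto intro!: norm_triangle_le add_mono)
  have "majorant L v \<le> majorant L (\<lambda>x. u x + v x) - L a"
    if "\<And>x. norm (apply_bcontfun a x) \<le> u x" for a
    by (rule majorant_leI[OF v]) (use sum_le[OF that] in \<open>simp add: le_diff_eq add.commute\<close>)
  then have "majorant L u \<le> majorant L (\<lambda>x. u x + v x) - majorant L v"
    by (intro majorant_leI[OF u]) (simp add: le_diff_eq add.commute)
  then show "majorant L u + majorant L v \<le> majorant L (\<lambda>x. u x + v x)"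
    by simp
qed

text \<open>
  Dominated convergence for a bounded functional, obtained from that for its majorant.
\<close>

lemma functional_small_if_pointwise_null:
  fixes h :: "nat \<Rightarrow> 'a \<Rightarrow>\<^sub>C 'b"
  assumes bound: "\<And>n x. norm (apply_bcontfun (h n) x) \<le> B"
    and lim: "\<And>x. (\<lambda>n. apply_bcontfun (h n) x) \<longlonglongrightarrow> 0"
    and "0 < e"
  shows "\<exists>n. \<bar>L (h n)\<bar> < e"
proof -
  let ?g = "\<lambda>n x. norm (apply_bcontfun (h n) x)"
  have g: "?g n \<in> cont_nonneg" for n
    by (auto simp: cont_nonneg_def intro!: continuous_intros)
  have "\<exists>n. majorant L (?g n) < e"
  proof (rule dominated_convergence_additive[OF K majorant_add majorant_nonneg majorant_le_onorm_mult])
    show "(\<lambda>n. ?g n x) \<longlonglongrightarrow> 0" for x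
      using lim[of x] by (rule tendsto_norm_zero)
  qed (use g bound \<open>0 < e\<close> in auto)
  then obtain n where n: "majorant L (?g n) < e"
    by blast
  have "L (h n) \<le> majorant L (?g n)" "L (- h n) \<le> majorant L (?g n)"
    by (rule le_majorant[OF g], simp)+
  then show ?thesis
    using n by (intro exI[of _ n]) (auto simp: L.neg)
qed

end

section \<open>Separately continuous functions on compact spaces\<close>

text \<open>
  A cluster point of \<open>u\<close> along \<open>F\<close>, described by the closed conditions that it inherits.  In a
  compact space that is not first countable it takes the place of the limit of a subsequence.
\<close>

lemma cluster_point_in_closed_sets:
  fixes u :: "'i \<Rightarrow> 'a::topological_space"
  assumes "compact (UNIV :: 'a set)" and "F \<noteq> bot"
  obtains z where "\<And>C. closed C \<Longrightarrow> \<forall>\<^sub>F n in F. u n \<in> C \<Longrightarrow> z \<in> C"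
proof -
  have "filtermap u F \<noteq> bot"
    using assms(2) by (simp add: filtermap_bot_iff)
  then obtain z where z: "inf (nhds z) (filtermap u F) \<noteq> bot"
    using assms(1) unfolding compact_filter by auto
  show ?thesis
  proof (rule that[of z], rule ccontr)
    fix C assume C: "closed C" "\<forall>\<^sub>F n in F. u n \<in> C" "z \<notin> C"
    have "\<forall>\<^sub>F y in inf (nhds z) (filtermap u F). False"
      unfolding eventually_inf eventually_filtermap
    proof (intro exI conjI)
      show "\<forall>\<^sub>F y in nhds z. y \<in> - C"
        using C by (intro eventually_nhds_in_open) auto
      show "\<forall>\<^sub>F n in F. u n \<in> C"
        by (rule C(2))
    qed simp
    then show False
      using z by (simp add: eventually_False)
  qed
qed

lemma finite_net_for_finitely_many_functions:
  fixes D :: "'a::topological_space \<Rightarrow> 'i \<Rightarrow> 'b::metric_space"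
  assumes "compact (UNIV :: 'a set)" and "finite Y" and "0 < e"
    and cont: "\<And>y. continuous_on UNIV (\<lambda>x. D x y)"
  shows "\<exists>X. finite X \<and> (\<forall>x. \<exists>x'\<in>X. \<forall>y\<in>Y. dist (D x y) (D x' y) < e)"
proof -
  let ?U = "\<lambda>x'. \<Inter>y\<in>Y. {x. dist (D x y) (D x' y) < e}"
  have op: "open (?U x')" for x'
    using \<open>finite Y\<close> cont by (intro open_INT ballI open_Collect_less continuous_intros) auto
  have cover: "UNIV \<subseteq> (\<Union>x'. ?U x')"
    using \<open>0 < e\<close> by auto
  obtain X where X: "finite X" "UNIV \<subseteq> (\<Union>x'\<in>X. ?U x')"
    by (rule compactE_image[OF assms(1) op cover])
  have "\<exists>x'\<in>X. \<forall>y\<in>Y. dist (D x y) (D x' y) < e" for x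
    using subsetD[OF X(2), of x] by auto
  then show ?thesis
    using X(1) by auto
qed

text \<open>
  The point \<open>y0\<close> need not be the limit of a sequence in \<open>S\<close>, yet a sequence can be found whose
  sections converge as if it were.  It is built together with finite sets: the \<open>k\<close>-th one is
  so dense that every \<open>x\<close> is imitated on the earlier points \<open>y 0, ..., y (k - 1)\<close> up to
  \<open>1 / (k + 1)\<close>, and \<open>y n\<close> is chosen in \<open>S\<close> so close to \<open>y0\<close> that \<open>D x (y n)\<close> is small for all \<open>x\<close>
  in the first \<open>n + 1\<close> finite sets.
  
  Suppose that \<open>D x (y n)\<close> did not tend to \<open>0\<close>, and let \<open>z\<close> be a cluster point of those \<open>y n\<close> where it
  is large.  A cluster point \<open>x'\<close> of better and better imitations of \<open>x\<close> agrees with \<open>x\<close> on all \<open>y n\<close>,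
  hence on \<open>z\<close>.  But \<open>D x' z = 0\<close>, because \<open>D\<close> vanishes at \<open>z\<close> for every member of the finite sets.
\<close>

lemma pointwise_null_sequence_in_set:
  fixes D :: "'a::topological_space \<Rightarrow> 'c::topological_space \<Rightarrow> 'b::real_normed_vector"
  assumes compact: "compact (UNIV :: 'a set)" "compact (UNIV :: 'c set)"
    and cont1: "\<And>y. continuous_on UNIV (\<lambda>x. D x y)"
    and cont2: "\<And>x. continuous_on UNIV (\<lambda>y. D x y)"
    and y0: "y0 \<in> closure S" "\<And>x. D x y0 = 0"
  obtains y where "\<And>n. y n \<in> S" "\<And>x. (\<lambda>n. D x (y n)) \<longlonglongrightarrow> 0"
proof -
  let ?net = "\<lambda>Y n X. finite X \<and> (\<forall>x. \<exists>x'\<in>X. \<forall>y\<in>Y. dist (D x y) (D x' y) < inverse (real (Suc n)))"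
  have "\<exists>X. ?net Y n X" if "finite Y" for Y n
    using finite_net_for_finitely_many_functions[of Y "inverse (real (Suc n))" D] compact(1) that cont1 by auto
  then obtain net where net: "\<And>Y n. finite Y \<Longrightarrow> ?net Y n (net Y n)"
    by metis
  have select: "\<exists>y\<in>S. \<forall>x\<in>Z. norm (D x y) < e" if "finite Z" "0 < e" for Z e
  proof -
    let ?V = "\<Inter>x\<in>Z. {y. norm (D x y) < e}"
    have "open ?V"
      using \<open>finite Z\<close> cont2 by (intro open_INT ballI open_Collect_less continuous_intros) auto
    moreover have "y0 \<in> ?V"
      using y0(2) \<open>0 < e\<close> by simp
    ultimately have "?V \<inter> S \<noteq> {}"
      using y0(1) by (metis closure_iff_nhds_not_empty inf_commute order_refl)
    then show ?thesis
      by blast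
  qed
  have "\<exists>y. \<forall>n. y n \<in> S \<and> (\<forall>k\<le>n. \<forall>x\<in>net (y ` {..<k}) k. norm (D x (y n)) < inverse (real (Suc n)))"
  proof (rule dependent_wellorder_choice)
    fix r n and f g :: "nat \<Rightarrow> 'c"
    assume fg: "\<And>k. k < n \<Longrightarrow> f k = g k"
    have "f ` {..<k} = g ` {..<k}" if "k \<le> n" for k
      using that fg by (intro image_cong) auto
    then show "(r \<in> S \<and> (\<forall>k\<le>n. \<forall>x\<in>net (f ` {..<k}) k. norm (D x r) < inverse (real (Suc n)))) =
      (r \<in> S \<and> (\<forall>k\<le>n. \<forall>x\<in>net (g ` {..<k}) k. norm (D x r) < inverse (real (Suc n))))"
      by auto
  next
    fix n and f :: "nat \<Rightarrow> 'c"
    have "finite (\<Union>k\<le>n. net (f ` {..<k}) k)"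
      using net by auto
    from select[OF this, of "inverse (real (Suc n))"]
    show "\<exists>r. r \<in> S \<and> (\<forall>k\<le>n. \<forall>x\<in>net (f ` {..<k}) k. norm (D x r) < inverse (real (Suc n)))"
      by auto
  qed
  then obtain y where y_S: "\<And>n. y n \<in> S"
    and y_small: "\<And>n k x. k \<le> n \<Longrightarrow> x \<in> net (y ` {..<k}) k \<Longrightarrow> norm (D x (y n)) < inverse (real (Suc n))"
    by blast
  have "(\<lambda>n. D x (y n)) \<longlonglongrightarrow> 0" for x
  proof (rule ccontr)
    assume "\<not> ?thesis"
    then obtain e where "0 < e" and "\<not> (\<forall>\<^sub>F n in sequentially. norm (D x (y n)) < e)"
      by (auto simp: tendsto_iff)
    define F where "F = inf sequentially (principal {n. e \<le> norm (D x (y n))})"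
    have "F \<noteq> bot"
      using \<open>\<not> (\<forall>\<^sub>F n in sequentially. _ n)\<close>
      unfolding F_def trivial_limit_def eventually_inf_principal by (simp add: not_le)
    then obtain z where z: "\<And>C. closed C \<Longrightarrow> \<forall>\<^sub>F n in F. y n \<in> C \<Longrightarrow> z \<in> C"
      using cluster_point_in_closed_sets[OF compact(2), of F y] by blast
    have "z \<in> {y. e \<le> norm (D x y)}"
      using cont2 by (intro z closed_Collect_le continuous_intros) (auto simp: F_def eventually_inf_principal)
    have "D x' z = 0" if "x' \<in> net (y ` {..<k}) k" for x' k
    proof -
      have "norm (D x' z) \<le> d" if "0 < d" for d
      proof -
        obtain n0 where n0: "inverse (real (Suc n0)) < d"
          using reals_Archimedean[OF \<open>0 < d\<close>] by blast
        have "norm (D x' (y n)) \<le> d" if "n \<ge> max n0 k" for n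
        proof -
          have "inverse (real (Suc n)) \<le> inverse (real (Suc n0))"
            using that by (intro le_imp_inverse_le) auto
          moreover have "norm (D x' (y n)) < inverse (real (Suc n))"
            using y_small[of k n x'] \<open>x' \<in> _\<close> that by simp
          ultimately show ?thesis
            using n0 by linarith
        qed
        then have "\<forall>\<^sub>F n in F. y n \<in> {y. norm (D x' y) \<le> d}"
          unfolding F_def by (intro filter_leD[OF inf_le1] eventually_sequentiallyI[of "max n0 k"]) auto
        moreover have "closed {y. norm (D x' y) \<le> d}"
          using cont2 by (intro closed_Collect_le continuous_intros)
        ultimately show ?thesis
          using z by blast
      qed
      then have "norm (D x' z) \<le> 0"
        using field_le_epsilon[of "norm (D x' z)" 0] by simp
      then show ?thesis by simp
    qed
    note null = this
    \<comment> \<open>\<open>q k\<close> imitates \<open>x\<close> on the first \<open>k\<close> points.\<close>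
    have "\<exists>x'. x' \<in> net (y ` {..<k}) k \<and>
        (\<forall>i<k. dist (D x (y i)) (D x' (y i)) < inverse (real (Suc k)))" for k
      using spec[OF conjunct2[OF net[of "y ` {..<k}" k]], of x] by fastforce
    then obtain q where q: "\<And>k. q k \<in> net (y ` {..<k}) k"
      "\<And>k i. i < k \<Longrightarrow> dist (D x (y i)) (D (q k) (y i)) < inverse (real (Suc k))"
      by metis
    obtain x' where x': "\<And>C. closed C \<Longrightarrow> \<forall>\<^sub>F k in sequentially. q k \<in> C \<Longrightarrow> x' \<in> C"
      using cluster_point_in_closed_sets[OF compact(1) sequentially_bot, of q] by blast
    have "x' \<in> {x. D x z = 0}"
      using cont1 by (intro x' closed_Collect_eq continuous_intros) (auto simp: null[OF q(1)])
    have same: "D x (y i) = D x' (y i)" for i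
    proof -
      have "dist (D x (y i)) (D x' (y i)) \<le> d" if "0 < d" for d
      proof -
        obtain n0 where n0: "inverse (real (Suc n0)) < d"
          using reals_Archimedean[OF \<open>0 < d\<close>] by blast
        have "dist (D x (y i)) (D (q k) (y i)) \<le> d" if "k \<ge> max n0 (Suc i)" for k
        proof -
          have "inverse (real (Suc k)) \<le> inverse (real (Suc n0))"
            using that by (intro le_imp_inverse_le) auto
          moreover have "dist (D x (y i)) (D (q k) (y i)) < inverse (real (Suc k))"
            using that by (intro q(2)) auto
          ultimately show ?thesis
            using n0 by linarith
        qed
        then have "\<forall>\<^sub>F k in sequentially. q k \<in> {x'. dist (D x (y i)) (D x' (y i)) \<le> d}"
          by (intro eventually_sequentiallyI[of "max n0 (Suc i)"]) auto
        moreover have "closed {x'. dist (D x (y i)) (D x' (y i)) \<le> d}"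
          using cont1 by (intro closed_Collect_le continuous_intros)
        ultimately show ?thesis
          using x' by blast
      qed
      then have "dist (D x (y i)) (D x' (y i)) \<le> 0"
        using field_le_epsilon[of "dist (D x (y i)) (D x' (y i))" 0] by simp
      then show ?thesis by simp
    qed
    have "z \<in> {y. D x y = D x' y}"
      using cont2 by (intro z closed_Collect_eq) (auto simp: same)
    then show False
      using \<open>x' \<in> _\<close> \<open>z \<in> {y. e \<le> _ y}\<close> \<open>0 < e\<close> by simp
  qed
  then show ?thesis
    using that[of y] y_S by blast
qed

text \<open>
  If \<open>y0\<close> were in the closure of the points \<open>y\<close> where \<open>L (F y)\<close> and \<open>L (F y0)\<close> are far apart,
  there would be a sequence of such points along which \<open>F y - F y0\<close> tends to \<open>0\<close> pointwise, against
  dominated convergence.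
\<close>

lemma separately_continuous_imp_weakly_continuous:
  fixes F :: "'c::topological_space \<Rightarrow> 'a::topological_space \<Rightarrow>\<^sub>C 'b::real_normed_vector"
    and L :: "('a \<Rightarrow>\<^sub>C 'b) \<Rightarrow> real"
  assumes compact: "compact (UNIV :: 'a set)" "compact (UNIV :: 'c set)"
    and cont: "\<And>x. continuous_on UNIV (\<lambda>y. apply_bcontfun (F y) x)"
    and bound: "\<And>y x. norm (apply_bcontfun (F y) x) \<le> B"
    and L: "bounded_linear L"
  shows "continuous_on UNIV (\<lambda>y. L (F y))"
  unfolding continuous_on_def
proof (rule ballI, rule tendstoI)
  fix y0 and e :: real
  assume "0 < e"
  define S where "S = {y. e \<le> dist (L (F y)) (L (F y0))}"
  have "y0 \<notin> closure S"
  proof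
    assume y0: "y0 \<in> closure S"
    let ?D = "\<lambda>x y. apply_bcontfun (F y - F y0) x"
    obtain y where y: "\<And>n. y n \<in> S" "\<And>x. (\<lambda>n. ?D x (y n)) \<longlonglongrightarrow> 0"
      by (rule pointwise_null_sequence_in_set[of ?D y0 S])
        (use compact cont y0 in \<open>auto intro!: continuous_intros\<close>)
    have "norm (?D x (y n)) \<le> B + B" for n x
      using norm_triangle_ineq4[of "F (y n) x" "F y0 x"] bound[of "y n" x] bound[of y0 x] by simp
    then obtain n where "\<bar>L (F (y n) - F y0)\<bar> < e"
      using functional_small_if_pointwise_null[OF compact(1) L, of "\<lambda>n. F (y n) - F y0" "B + B" e]
        y(2) \<open>0 < e\<close> by blast
    then show False
      using y(1)[of n] by (simp add: S_def dist_norm linear_diff[OF bounded_linear.linear[OF L]])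
  qed
  moreover have "dist (L (F y)) (L (F y0)) < e" if "y \<notin> closure S" for y
    using that subsetD[OF closure_subset, of y S] by (force simp: S_def)
  ultimately show "\<forall>\<^sub>F y in at y0. dist (L (F y)) (L (F y0)) < e"
    unfolding eventually_at_topological by (intro exI[of _ "- closure S"]) auto
qed

section \<open>Point masses and the cone topology\<close>

lemma total_variation_point_mass:
  fixes x :: "'a::t2_space"
  assumes "E \<in> sets borel"
  shows "total_variation (point_mass x) E = indicator E x"
proof -
  let ?P = "{A::nat \<Rightarrow> 'a set. range A \<subseteq> sets borel \<and> disjoint_family A \<and> (\<Union>n. A n) = E}"
  have "(\<Sum>n. ennreal (cmod (point_mass x (A n)))) = indicator E x" if A: "A \<in> ?P" for A
  proof -
    have "ennreal (cmod (point_mass x (A n))) = indicator (A n) x" for n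
      using A by (auto simp: point_mass_def indicator_def)
    then show ?thesis
      using A suminf_indicator[of A x] by simp
  qed
  moreover have "(\<lambda>n. if n = 0 then E else {}) \<in> ?P"
    using assms by (auto simp: disjoint_family_on_def split: if_splits)
  then have "?P \<noteq> {}"
    by blast
  ultimately show ?thesis
    unfolding total_variation_def by simp
qed

lemma point_mass_in_M_plus: "point_mass x \<in> M_plus" for x :: "'a::t2_space"
proof -
  have "complex_borel_measure (point_mass x)"
    unfolding complex_borel_measure_def
  proof (intro conjI allI impI)
    fix A :: "nat \<Rightarrow> 'a set"
    assume A: "range A \<subseteq> sets borel" "disjoint_family A"
    then have U: "(\<Union>n. A n) \<in> sets borel"
      by (intro sets.countable_UN) auto
    show "(\<lambda>n. point_mass x (A n)) sums point_mass x (\<Union>n. A n)"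
    proof (cases "\<exists>m. x \<in> A m")
      case True
      then obtain m where m: "x \<in> A m" ..
      have "point_mass x (A n) = (if n = m then 1 else 0)" for n
        using A m by (auto simp: point_mass_def disjoint_family_on_def)
      moreover have "point_mass x (\<Union>n. A n) = 1"
        using U m by (auto simp: point_mass_def)
      ultimately show ?thesis
        using sums_single[of m "\<lambda>_. 1 :: complex"] by simp
    next
      case False
      then show ?thesis
        by (simp add: point_mass_def)
    qed
  qed (simp add: point_mass_def)
  moreover have "regular_measure (point_mass x)"
    unfolding regular_measure_def
  proof (intro ballI conjI)
    fix E :: "'a set" assume E: "E \<in> sets borel"
    have V: "total_variation (point_mass x) V = indicator V x" if "open V" for V
      using that by (intro total_variation_point_mass) simp
    show "total_variation (point_mass x) E = (INF V\<in>{V. open V \<and> E \<subseteq> V}. total_variation (point_mass x) V)"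
      unfolding total_variation_point_mass[OF E]
    proof (intro antisym INF_greatest)
      fix V assume "V \<in> {V. open V \<and> E \<subseteq> V}"
      then show "indicator E x \<le> total_variation (point_mass x) V"
        by (auto simp: V indicator_def)
    next
      let ?V = "if x \<in> E then UNIV else - {x}"
      show "(INF V\<in>{V. open V \<and> E \<subseteq> V}. total_variation (point_mass x) V) \<le> indicator E x"
        by (rule INF_lower2[of ?V]) (auto simp: V open_Compl)
    qed
    have C: "total_variation (point_mass x) C = indicator C x" if "compact C" for C
      using that by (intro total_variation_point_mass borel_closed compact_imp_closed)
    show "total_variation (point_mass x) E = (SUP C\<in>{C. compact C \<and> C \<subseteq> E}. total_variation (point_mass x) C)"
      unfolding total_variation_point_mass[OF E]
    proof (intro antisym SUP_least)
      fix C assume "C \<in> {C. compact C \<and> C \<subseteq> E}"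
      then show "total_variation (point_mass x) C \<le> indicator E x"
        by (auto simp: C indicator_def)
    next
      let ?C = "if x \<in> E then {x} else {}"
      show "indicator E x \<le> (SUP C\<in>{C. compact C \<and> C \<subseteq> E}. total_variation (point_mass x) C)"
        by (rule SUP_upper2[of ?C]) (auto simp: C)
    qed
  qed
  ultimately show ?thesis
    by (simp add: M_plus_def M_space_def point_mass_def)
qed

lemma to_measure_point_mass: "to_measure (point_mass x) = return borel x"
  by (rule measure_eqI)
    (auto simp: emeasure_to_measure point_mass_in_M_plus point_mass_def indicator_def)

lemma continuous_map_point_mass: "continuous_map euclidean cone_topology point_mass"
  unfolding cone_topology_def
proof (rule continuous_on_generated_topo)
  fix W :: "('a set \<Rightarrow> complex) set"
  assume "W \<in> {{\<mu> \<in> M_plus. (\<integral>x. f x \<partial>to_measure \<mu>) \<in> U} |f U. f \<in> Cc_plus \<union> {\<lambda>_. 1::real} \<and> open U}"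
  then obtain f :: "'a \<Rightarrow> real" and U where W: "W = {\<mu> \<in> M_plus. (\<integral>x. f x \<partial>to_measure \<mu>) \<in> U}"
    and "f \<in> Cc_plus \<union> {\<lambda>_. 1}" and U: "open U"
    by blast
  then have f: "continuous_on UNIV f"
    by (auto simp: Cc_plus_def)
  have "f \<in> borel_measurable borel"
    using f by (rule borel_measurable_continuous_onI)
  then have "point_mass -` W = f -` U"
    by (auto simp: W point_mass_in_M_plus to_measure_point_mass integral_return)
  then show "openin euclidean (point_mass -` W \<inter> topspace euclidean)"
    using f U by (simp add: open_vimage)
next
  have "M_plus \<in> {{\<mu> \<in> M_plus. (\<integral>x. f x \<partial>to_measure \<mu>) \<in> U} |f U. f \<in> Cc_plus \<union> {\<lambda>_. 1::real} \<and> open U}"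
    by (auto intro!: exI[of _ UNIV] exI[of _ "\<lambda>_. 1::real"])
  then show "point_mass ` topspace (euclidean :: 'a topology) \<subseteq>
      \<Union> {{\<mu> \<in> M_plus. (\<integral>x. f x \<partial>to_measure \<mu>) \<in> U} |f U. f \<in> Cc_plus \<union> {\<lambda>_. 1::real} \<and> open U}"
    using point_mass_in_M_plus by blast
qed

lemma continuous_map_integral_cone:
  assumes "f \<in> Cc_plus"
  shows "continuous_map cone_topology euclideanreal (\<lambda>\<mu>. \<integral>x. f x \<partial>to_measure \<mu>)"
  unfolding continuous_map_def
proof (intro conjI allI impI)
  fix U :: "real set" assume "openin euclideanreal U"
  then show "openin cone_topology {\<mu> \<in> topspace cone_topology. (\<integral>x. f x \<partial>to_measure \<mu>) \<in> U}"
    using assms unfolding topspace_cone_topology unfolding cone_topology_def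
    by (intro topology_generated_by_Basis) auto
qed auto

text \<open>
  The cone topology only tests against non-negative functions.  On a compact space adding a
  constant makes a continuous function non-negative, and for probability measures this changes
  its integral by that same constant.
\<close>

lemma continuous_on_integral_real:
  fixes m :: "'b::topological_space \<Rightarrow> 'a::t2_space set \<Rightarrow> complex" and f :: "'a \<Rightarrow> real"
  assumes K: "compact (UNIV :: 'a set)" and m: "continuous_map euclidean cone_topology m"
    and prob: "\<And>z. prob_space (to_measure (m z))"
    and f: "continuous_on UNIV f" "\<And>x. \<bar>f x\<bar> \<le> B"
  shows "continuous_on UNIV (\<lambda>z. \<integral>x. f x \<partial>to_measure (m z))"
proof -
  have "compact (closure {x. f x + B \<noteq> 0})"
    using compact_Int_closed[OF K closed_closure] by simp
  moreover have "0 \<le> f x + B" for x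
    using f(2)[of x] by (simp add: abs_le_iff)
  ultimately have "(\<lambda>x. f x + B) \<in> Cc_plus"
    using f by (auto simp: Cc_plus_def intro!: continuous_intros)
  from continuous_map_compose[OF m continuous_map_integral_cone[OF this]]
  have "continuous_on UNIV (\<lambda>z. (\<integral>x. f x + B \<partial>to_measure (m z)) - B)"
    by (intro continuous_intros) (simp add: o_def)
  moreover have "(\<integral>x. f x + B \<partial>to_measure (m z)) - B = (\<integral>x. f x \<partial>to_measure (m z))" for z
  proof -
    interpret prob_space "to_measure (m z)"
      by (rule prob)
    have "f \<in> borel_measurable (to_measure (m z))"
      using borel_measurable_continuous_onI[OF f(1)] by (simp cong: measurable_cong_sets)
    then have "integrable (to_measure (m z)) f"
      using f(2) by (intro integrable_const_bound[of _ B]) auto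
    then show ?thesis
      by (simp add: prob_space)
  qed
  ultimately show ?thesis
    by simp
qed

lemma integrable_bcontfun:
  fixes f :: "'a::t2_space \<Rightarrow> complex"
  assumes "prob_space (to_measure \<mu>)" and f: "f \<in> bcontfun"
  shows "integrable (to_measure \<mu>) f"
proof -
  interpret prob_space "to_measure \<mu>"
    by (rule assms)
  obtain B where "\<And>x. norm (f x) \<le> B"
    using f unfolding bcontfun_def bounded_iff by auto
  moreover have "f \<in> borel_measurable (to_measure \<mu>)"
    using f borel_measurable_continuous_onI[of f] by (simp add: bcontfun_def cong: measurable_cong_sets)
  ultimately show ?thesis
    by (intro integrable_const_bound[of _ B]) auto
qed

lemma continuous_on_integral_complex:
  fixes m :: "'b::topological_space \<Rightarrow> 'a::t2_space set \<Rightarrow> complex" and f :: "'a \<Rightarrow> complex"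
  assumes K: "compact (UNIV :: 'a set)" and m: "continuous_map euclidean cone_topology m"
    and prob: "\<And>z. prob_space (to_measure (m z))" and f: "f \<in> bcontfun"
  shows "continuous_on UNIV (\<lambda>z. \<integral>x. f x \<partial>to_measure (m z))"
proof -
  obtain B where B: "\<And>x. norm (f x) \<le> B"
    using f unfolding bcontfun_def bounded_iff by auto
  have cf: "continuous_on UNIV f"
    using f by (simp add: bcontfun_def)
  have "continuous_on UNIV (\<lambda>z. \<integral>x. Re (f x) \<partial>to_measure (m z))"
    using cf order_trans[OF abs_Re_le_cmod B]
    by (intro continuous_on_integral_real[OF K m prob, where B = B] continuous_intros)
  moreover have "continuous_on UNIV (\<lambda>z. \<integral>x. Im (f x) \<partial>to_measure (m z))"
    using cf order_trans[OF abs_Im_le_cmod B]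
    by (intro continuous_on_integral_real[OF K m prob, where B = B] continuous_intros)
  ultimately have "continuous_on UNIV
      (\<lambda>z. Complex (\<integral>x. Re (f x) \<partial>to_measure (m z)) (\<integral>x. Im (f x) \<partial>to_measure (m z)))"
    by (rule continuous_on_Complex)
  moreover have "Complex (\<integral>x. Re (f x) \<partial>to_measure (m z)) (\<integral>x. Im (f x) \<partial>to_measure (m z)) =
      (\<integral>x. f x \<partial>to_measure (m z))" for z
    using integrable_bcontfun[OF prob f] by (simp add: complex_eq_iff)
  ultimately show ?thesis
    by simp
qed

section \<open>The weak topology\<close>

lemma apply_bcontfun_in_complex_dual: "(\<lambda>h. apply_bcontfun h x) \<in> complex_dual"
proof -
  have "bounded_linear (\<lambda>h :: 'a \<Rightarrow>\<^sub>C complex. apply_bcontfun h x)"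
    by (rule bounded_linear_intro[where K = 1]) (auto simp: norm_bounded)
  moreover have "(\<lambda>x. c * apply_bcontfun h x) \<in> bcontfun" for c and h :: "'a \<Rightarrow>\<^sub>C complex"
    using bounded_apply_bcontfun[of h] bounded_scaling
    by (auto simp: bcontfun_def bounded_iff norm_mult intro!: continuous_intros)
      (meson mult_left_mono norm_ge_zero)
  ultimately show ?thesis
    by (simp add: complex_dual_def Bcontfun_inverse)
qed

text \<open>
  Point evaluations already separate the functions.
\<close>

lemma Hausdorff_weak_topology: "Hausdorff_space (weak_topology :: ('a::topological_space \<Rightarrow>\<^sub>C complex) topology)"
  unfolding Hausdorff_space_def
proof (intro allI impI)
  fix g h :: "'a \<Rightarrow>\<^sub>C complex"
  assume "g \<in> topspace weak_topology \<and> h \<in> topspace weak_topology \<and> g \<noteq> h"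
  then obtain x where "apply_bcontfun g x \<noteq> apply_bcontfun h x"
    using bcontfun_eqI by blast
  from hausdorff[OF this] obtain U V where UV: "open U" "open V"
    "apply_bcontfun g x \<in> U" "apply_bcontfun h x \<in> V" "U \<inter> V = {}"
    by auto
  have "openin weak_topology ((\<lambda>h :: 'a \<Rightarrow>\<^sub>C complex. apply_bcontfun h x) -` W)" if "open W" for W
    unfolding weak_topology_def using that apply_bcontfun_in_complex_dual
    by (intro topology_generated_by_Basis) blast
  then show "\<exists>U V. openin weak_topology U \<and> openin weak_topology V \<and> g \<in> U \<and> h \<in> V \<and> disjnt U V"
    using UV by (intro exI[of _ "(\<lambda>h. apply_bcontfun h x) -` U"] exI[of _ "(\<lambda>h. apply_bcontfun h x) -` V"])
      (auto simp: disjnt_def)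
qed

lemma continuous_map_weak_topologyI:
  fixes F :: "'b::topological_space \<Rightarrow> 'a::topological_space \<Rightarrow>\<^sub>C complex"
  assumes "\<And>\<phi>. \<phi> \<in> complex_dual \<Longrightarrow> continuous_on UNIV (\<lambda>y. \<phi> (F y))"
  shows "continuous_map euclidean weak_topology F"
  unfolding weak_topology_def
proof (rule continuous_on_generated_topo)
  fix W :: "('a \<Rightarrow>\<^sub>C complex) set"
  assume "W \<in> {\<phi> -` U |\<phi> U. \<phi> \<in> complex_dual \<and> open U}"
  then obtain \<phi> :: "('a \<Rightarrow>\<^sub>C complex) \<Rightarrow> complex" and U where W: "W = \<phi> -` U" and \<phi>: "\<phi> \<in> complex_dual" and U: "open U"
    by blast
  have "F -` W = (\<lambda>y. \<phi> (F y)) -` U"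
    by (auto simp: W)
  then show "openin euclidean (F -` W \<inter> topspace euclidean)"
    using open_vimage[OF U assms[OF \<phi>]] by simp
next
  show "F ` topspace euclidean \<subseteq> \<Union> {\<phi> -` U |\<phi> U. \<phi> \<in> complex_dual \<and> open U}"
    using topspace_weak_topology[where ?'a = 'a]
    unfolding weak_topology_def topology_generated_by_topspace by simp
qed

section \<open>Translates on a compact semihypergroup\<close>

theorem proposition4p10:
  fixes conv :: "('a::t2_space set \<Rightarrow> complex) \<Rightarrow> ('a set \<Rightarrow> complex) \<Rightarrow> ('a set \<Rightarrow> complex)"
  assumes "semitopological_semihypergroup conv"
    and "compact (UNIV :: 'a set)"
  shows "WAP_r conv = bcontfun"
proof
  show "WAP_r conv \<subseteq> bcontfun"
    by (auto simp: WAP_r_def)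
next
  interpret semitopological_semihypergroup conv
    by (rule assms(1))
  show "bcontfun \<subseteq> WAP_r conv"
  proof
    fix f :: "'a \<Rightarrow> complex" assume f: "f \<in> bcontfun"
    let ?R = "\<lambda>y. right_translate conv y f"
    have cont_x: "continuous_on UNIV (?R y)" for y
      unfolding right_translate_def
      using continuous_map_compose[OF continuous_map_point_mass continuous_left[OF point_mass_in_M_plus]]
      by (intro continuous_on_integral_complex[OF assms(2) _ probability f]) (simp add: o_def)
    have cont_y: "continuous_on UNIV (\<lambda>y. ?R y x)" for x
      unfolding right_translate_def
      using continuous_map_compose[OF continuous_map_point_mass continuous_right[OF point_mass_in_M_plus]]
      by (intro continuous_on_integral_complex[OF assms(2) _ probability f]) (simp add: o_def)
    obtain B where B: "\<And>x. norm (f x) \<le> B"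
      using f unfolding bcontfun_def bounded_iff by auto
    have R_le: "norm (?R y x) \<le> B" for x y
    proof -
      let ?M = "to_measure (conv (point_mass x) (point_mass y))"
      interpret prob_space ?M
        by (rule probability)
      have "norm (?R y x) \<le> (\<integral>t. norm (f t) \<partial>?M)"
        unfolding right_translate_def by (rule integral_norm_bound)
      also have "\<dots> \<le> B"
        using B integrable_norm[OF integrable_bcontfun[OF probability f]] by (intro integral_le_const) auto
      finally show ?thesis .
    qed
    have R: "?R y \<in> bcontfun" for y
      using cont_x R_le by (auto simp: bcontfun_def bounded_iff)
    define F where "F y = Bcontfun (?R y)" for y
    have F: "apply_bcontfun (F y) = ?R y" for y
      using R by (simp add: F_def Bcontfun_inverse)
    have "continuous_map euclidean weak_topology F"
    proof (rule continuous_map_weak_topologyI)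
      fix \<phi> :: "('a \<Rightarrow>\<^sub>C complex) \<Rightarrow> complex" assume "\<phi> \<in> complex_dual"
      then have \<phi>: "bounded_linear \<phi>"
        by (simp add: complex_dual_def)
      have "continuous_on UNIV (\<lambda>y. L (F y))" if "bounded_linear L" for L :: "('a \<Rightarrow>\<^sub>C complex) \<Rightarrow> real"
        using cont_y R_le that by (intro separately_continuous_imp_weakly_continuous[OF assms(2,2), where B = B]) (simp_all add: F)
      then have "continuous_on UNIV (\<lambda>y. Re (\<phi> (F y)))" "continuous_on UNIV (\<lambda>y. Im (\<phi> (F y)))"
        using bounded_linear_compose[OF bounded_linear_Re \<phi>] bounded_linear_compose[OF bounded_linear_Im \<phi>]
        by blast+
      then have "continuous_on UNIV (\<lambda>y. Complex (Re (\<phi> (F y))) (Im (\<phi> (F y))))"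
        by (rule continuous_on_Complex)
      then show "continuous_on UNIV (\<lambda>y. \<phi> (F y))"
        by simp
    qed
    then have "compactin weak_topology (range F)"
      using image_compactin[of euclidean UNIV weak_topology F] assms(2) by simp
    moreover from this have "weak_topology closure_of range F = range F"
      using compactin_imp_closedin[OF Hausdorff_weak_topology] closure_of_eq by metis
    ultimately have "relatively_compact_in weak_topology (range F)"
      by (simp add: relatively_compact_in_def)
    then show "f \<in> WAP_r conv"
      using f R by (simp add: WAP_r_def F_def[abs_def])
  qed
qed

end
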